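(* Each unital separable residually finite dimensional just-infinite $C^*$-algebra is strictly residually finite dimensional.
   Context: A $C^*$-algebra $A$ is just-infinite if it is infinite dimensional and $A/I$ is finite dimensional for each non-zero closed two-sided ideal $I$ of $A$. A $C^*$-algebra is residually finite dimensional (RFD) if it admits a separating family of finite dimensional representations. A unital $C^*$-algebra $A$ is strictly residually finite dimensional (strictly RFD) if there exists an infinite family $\{\pi_i \colon A \to M_{k_i}(\mathbb{C})\}_{i \in \mathbb{I}}$ of irreducible, pairwise (unitarily) inequivalent, finite dimensional representations of $A$ such that the map $\Psi_T = \bigoplus_{i \in T} \pi_i \colon A \to \prod_{i \in T} M_{k_i}(\mathbb{C})$ is injective for each infinite subset $T$ of $\mathbb{I}$. *)

theory Defs
  imports
    "HOL-Analysis.Analysis"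
    "Jordan_Normal_Form.Schur_Decomposition"
    "Jordan_Normal_Form.VS_Connect"
begin

class cstar_algebra = banach + real_normed_algebra +
  fixes scaleC :: "complex \<Rightarrow> 'a \<Rightarrow> 'a" (infixr "*\<^sub>C" 75)
    and star :: "'a \<Rightarrow> 'a"
  assumes scaleC_add_right: "c *\<^sub>C (x + y) = c *\<^sub>C x + c *\<^sub>C y"
    and scaleC_add_left: "(c + d) *\<^sub>C x = c *\<^sub>C x + d *\<^sub>C x"
    and scaleC_scaleC: "c *\<^sub>C d *\<^sub>C x = (c * d) *\<^sub>C x"
    and scaleR_scaleC: "r *\<^sub>R x = complex_of_real r *\<^sub>C x"
    and mult_scaleC_left: "(c *\<^sub>C x) * y = c *\<^sub>C (x * y)"
    and mult_scaleC_right: "x * (c *\<^sub>C y) = c *\<^sub>C (x * y)"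
    and norm_scaleC: "norm (c *\<^sub>C x) = cmod c * norm x"
    and star_star: "star (star x) = x"
    and star_add: "star (x + y) = star x + star y"
    and star_scaleC: "star (c *\<^sub>C x) = cnj c *\<^sub>C star x"
    and star_mult: "star (x * y) = star y * star x"
    and cstar_identity: "norm (star x * x) = (norm x)\<^sup>2"

text \<open>The class \<open>ring_1\<close> contains the axiom \<open>0 \<noteq> 1\<close>, which excludes only the zero algebra.\<close>

class unital_cstar_algebra = cstar_algebra + ring_1
begin

subclass real_normed_algebra_1
proof
  have idem: "r = 1" if "r = r\<^sup>2" "r \<noteq> 0" for r :: real
    using that by (simp add: monoid_mult_class.power2_eq_square)
  have "star 1 * 1 = (1 :: 'a)"
    by (metis mult_1_right star_mult star_star)
  then have sq: "norm (1 :: 'a) = (norm (1 :: 'a))\<^sup>2"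
    using cstar_identity[of 1] by simp
  show "norm (1 :: 'a) = 1"
    by (rule idem[OF sq]) simp
qed

end

global_interpretation complex_vector: vector_space "scaleC :: complex \<Rightarrow> 'a \<Rightarrow> 'a :: cstar_algebra"
  defines cspan = complex_vector.span
    and csubspace = complex_vector.subspace
proof
  fix x :: 'a
  show "1 *\<^sub>C x = x"
    using scaleR_scaleC[of 1 x] by simp
qed (simp_all add: scaleC_add_right scaleC_add_left scaleC_scaleC)

definition closed_two_sided_ideal :: "'a::cstar_algebra set \<Rightarrow> bool" where
  "closed_two_sided_ideal I \<longleftrightarrow>
     closed I \<and> csubspace I \<and> (\<forall>a. \<forall>x\<in>I. a * x \<in> I \<and> x * a \<in> I)"

definition infinite_dimensional :: "'a::cstar_algebra itself \<Rightarrow> bool" where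
  "infinite_dimensional _ \<longleftrightarrow> (\<nexists>B :: 'a set. finite B \<and> cspan B = UNIV)"

text \<open>
  The elements of \<open>A/I\<close> are the cosets \<open>(+) a ` I\<close>. As the quotient map is linear, the span in
  \<open>A/I\<close> of the cosets of the elements of \<open>B\<close> is the set of cosets of the elements of \<open>cspan B\<close>.
\<close>

definition finite_dimensional_quotient :: "'a::cstar_algebra set \<Rightarrow> bool" where
  "finite_dimensional_quotient I \<longleftrightarrow>
     (\<exists>B. finite B \<and> (\<lambda>b. (+) b ` I) ` cspan B = range (\<lambda>a. (+) a ` I))"

definition just_infinite :: "'a::cstar_algebra itself \<Rightarrow> bool" where
  "just_infinite A \<longleftrightarrow> infinite_dimensional A \<and>
     (\<forall>I :: 'a set. closed_two_sided_ideal I \<and> I \<noteq> {0} \<longrightarrow> finite_dimensional_quotient I)"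

text \<open>
  Representations on \<open>\<complex>\<^sup>k\<close>, i.e. *-homomorphisms into the \<open>k \<times> k\<close> matrices; they are not required
  to be unital.
\<close>

definition fd_representation :: "nat \<Rightarrow> ('a::cstar_algebra \<Rightarrow> complex mat) \<Rightarrow> bool" where
  "fd_representation k \<pi> \<longleftrightarrow>
     (\<forall>a. \<pi> a \<in> carrier_mat k k) \<and>
     (\<forall>a b. \<pi> (a + b) = \<pi> a + \<pi> b) \<and>
     (\<forall>c a. \<pi> (c *\<^sub>C a) = c \<cdot>\<^sub>m \<pi> a) \<and>
     (\<forall>a b. \<pi> (a * b) = \<pi> a * \<pi> b) \<and>
     (\<forall>a. \<pi> (star a) = mat_adjoint (\<pi> a))"

text \<open>Zero representations, in particular the one on \<open>\<complex>\<^sup>0\<close>, do not count as irreducible.\<close>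

definition irreducible_representation :: "nat \<Rightarrow> ('a::cstar_algebra \<Rightarrow> complex mat) \<Rightarrow> bool" where
  "irreducible_representation k \<pi> \<longleftrightarrow> fd_representation k \<pi> \<and> (\<exists>a. \<pi> a \<noteq> 0\<^sub>m k k) \<and>
     (\<forall>W. VectorSpace.subspace class_ring W (module_vec TYPE(complex) k) \<and>
          (\<forall>a. \<forall>w\<in>W. \<pi> a *\<^sub>v w \<in> W) \<longrightarrow> W = {0\<^sub>v k} \<or> W = carrier_vec k)"

definition unitarily_equivalent ::
    "nat \<Rightarrow> ('a \<Rightarrow> complex mat) \<Rightarrow> nat \<Rightarrow> ('a \<Rightarrow> complex mat) \<Rightarrow> bool" where
  "unitarily_equivalent k \<pi> l \<rho> \<longleftrightarrow> k = l \<and>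
     (\<exists>U \<in> carrier_mat k k. mat_adjoint U * U = 1\<^sub>m k \<and> U * mat_adjoint U = 1\<^sub>m k \<and>
        (\<forall>a. \<rho> a = U * \<pi> a * mat_adjoint U))"

definition residually_finite_dimensional :: "'a::cstar_algebra itself \<Rightarrow> bool" where
  "residually_finite_dimensional _ \<longleftrightarrow>
     (\<exists>\<F> :: (nat \<times> ('a \<Rightarrow> complex mat)) set.
        (\<forall>(k, \<pi>)\<in>\<F>. fd_representation k \<pi>) \<and>
        (\<forall>a. a \<noteq> 0 \<longrightarrow> (\<exists>(k, \<pi>)\<in>\<F>. \<pi> a \<noteq> 0\<^sub>m k k)))"

definition strictly_rfd_family ::
    "'i set \<Rightarrow> ('i \<Rightarrow> nat) \<Rightarrow> ('i \<Rightarrow> 'a::cstar_algebra \<Rightarrow> complex mat) \<Rightarrow> bool" where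
  "strictly_rfd_family J k \<pi> \<longleftrightarrow> infinite J \<and>
     (\<forall>i\<in>J. irreducible_representation (k i) (\<pi> i)) \<and>
     (\<forall>i\<in>J. \<forall>j\<in>J. i \<noteq> j \<longrightarrow> \<not> unitarily_equivalent (k i) (\<pi> i) (k j) (\<pi> j)) \<and>
     (\<forall>T. T \<subseteq> J \<and> infinite T \<longrightarrow> inj (\<lambda>a. \<lambda>i\<in>T. \<pi> i a))"

text \<open>
  HOL cannot quantify over the type of indices inside a formula. The index type chosen here is no
  restriction, by the lemma \<open>strictly_rfdI\<close>: the members of a pairwise inequivalent family are
  distinct, so every such family can be indexed by its own members.
\<close>

definition strictly_rfd :: "'a::unital_cstar_algebra itself \<Rightarrow> bool" where
  "strictly_rfd _ \<longleftrightarrow>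
     (\<exists>(J :: (nat \<times> ('a \<Rightarrow> complex mat)) set) k (\<pi> :: _ \<Rightarrow> 'a \<Rightarrow> complex mat).
        strictly_rfd_family J k \<pi>)"

lemma mat_adjoint_one: "mat_adjoint (1\<^sub>m k :: complex mat) = 1\<^sub>m k"
  by (rule eq_matI) (auto simp: mat_adjoint_def mat_of_rows_def unit_vec_def)

lemma unitarily_equivalent_refl:
  assumes "fd_representation k \<pi>"
  shows "unitarily_equivalent k \<pi> k \<pi>"
proof -
  have "\<pi> a \<in> carrier_mat k k" for a
    using assms by (simp add: fd_representation_def)
  then show ?thesis
    unfolding unitarily_equivalent_def
    by (intro conjI bexI[of _ "1\<^sub>m k"])
      (auto simp: mat_adjoint_one left_mult_one_mat[of _ k k] right_mult_one_mat[of _ k k])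
qed

lemma strictly_rfdI:
  fixes J :: "'i set" and \<pi> :: "'i \<Rightarrow> 'a::unital_cstar_algebra \<Rightarrow> complex mat"
  assumes "strictly_rfd_family J k \<pi>"
  shows "strictly_rfd TYPE('a)"
proof -
  define f where "f i = (k i, \<pi> i)" for i
  have inf: "infinite J"
    and irr: "\<And>i. i \<in> J \<Longrightarrow> irreducible_representation (k i) (\<pi> i)"
    and ineq: "\<And>i j. \<lbrakk>i \<in> J; j \<in> J; i \<noteq> j\<rbrakk> \<Longrightarrow> \<not> unitarily_equivalent (k i) (\<pi> i) (k j) (\<pi> j)"
    and inj: "\<And>T. \<lbrakk>T \<subseteq> J; infinite T\<rbrakk> \<Longrightarrow> inj (\<lambda>a. \<lambda>i\<in>T. \<pi> i a)"
    using assms by (auto simp: strictly_rfd_family_def)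
  have injf: "inj_on f J"
  proof (rule inj_onI, rule ccontr)
    fix i j assume "i \<in> J" "j \<in> J" "f i = f j" "i \<noteq> j"
    then show False
      using ineq[of i j] irr[of i] unitarily_equivalent_refl[of "k i" "\<pi> i"]
      by (auto simp: f_def irreducible_representation_def)
  qed
  have "inj (\<lambda>a. \<lambda>p\<in>T. snd p a)" if T: "T \<subseteq> f ` J" "infinite T" for T
  proof -
    define S where "S = {i\<in>J. f i \<in> T}"
    have TS: "T = f ` S"
      using T(1) by (auto simp: S_def)
    have S: "S \<subseteq> J"
      by (simp add: S_def)
    have S': "infinite S"
      using T(2) TS finite_imageI by metis
    show ?thesis
    proof (rule injI)
      fix a b assume eq: "(\<lambda>p\<in>T. snd p a) = (\<lambda>p\<in>T. snd p b)"
      have "\<pi> i a = \<pi> i b" if "i \<in> S" for i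
      proof -
        have "f i \<in> T"
          using that by (simp add: S_def)
        then show ?thesis
          using fun_cong[OF eq, of "f i"] by (simp add: f_def)
      qed
      then have "(\<lambda>i\<in>S. \<pi> i a) = (\<lambda>i\<in>S. \<pi> i b)"
        by (auto simp: restrict_def)
      then show "a = b"
        using inj[OF S S'] by (auto dest: injD)
    qed
  qed
  moreover have "infinite (f ` J)"
    using inf injf by (simp add: finite_image_iff)
  ultimately have "strictly_rfd_family (f ` J) fst snd"
    using irr ineq unfolding strictly_rfd_family_def by (auto simp: f_def)
  then show ?thesis
    unfolding strictly_rfd_def by blast
qed

end

theory Submission
  imports Defs
begin

text \<open>
  Every infinite family of irreducible finite dimensional representations with pairwise distinct
  kernels is separating: the common kernel \<open>I\<close> is a closed ideal, and if it were non-zero, then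
  the finite dimensional algebra \<open>A/I\<close> would have infinitely many prime ideals. By residual finite
  dimensionality the kernels of all irreducible finite dimensional representations intersect in
  \<open>0\<close>; as \<open>A\<close> is infinite dimensional, there are infinitely many of them, and one representation
  for each kernel gives the required family.
\<close>

section \<open>Complex matrices\<close>

text \<open>Elementary matrix arguments stand in for three structural tools. Instead of Wedderburn
  theory, extremal choices of dimension show that only finitely many prime ideals lie above a set of
  finite codimension; of the kernels, this uses primeness and not maximality. Instead of complete
  reducibility, a representation of least dimension that does not vanish at a given element is shown
  to be irreducible. Instead of automatic continuity, the Neumann series bounds the eigenvalues of
  \<open>\<pi> c\<close> by \<open>norm c\<close>; since the trace of
  \<open>mat_adjoint A * A\<close> is the sum of the squared moduli of the entries of
  \<open>A\<close>, this bound is enough to make kernels closed.\<close>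

lemma mult_mat_vec_in_carrier [simp]: "A *\<^sub>v v \<in> carrier_vec n \<longleftrightarrow> dim_row A = n"
  by (metis carrier_vecD carrier_vecI dim_mult_mat_vec)

lemma mult_mat_in_carrier [simp]: "A * B \<in> carrier_mat n m \<longleftrightarrow> dim_row A = n \<and> dim_col B = m"
  by (metis carrier_matD carrier_matI index_mult_mat(2,3))

lemma dim_mat_adjoint [simp]:
  "dim_row (mat_adjoint A) = dim_col A" "dim_col (mat_adjoint A) = dim_row A"
  by (simp_all add: mat_adjoint_def)

lemma mat_adjoint_in_carrier [simp]:
  "mat_adjoint A \<in> carrier_mat n m \<longleftrightarrow> A \<in> carrier_mat m n"
  by (metis carrier_matD carrier_matI dim_mat_adjoint)

lemma assoc_mult_mat_dim:
  "dim_col A = dim_row B \<Longrightarrow> dim_col B = dim_row C \<Longrightarrow> (A * B) * C = A * (B * (C :: 'a::semiring_0 mat))"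
  by (rule assoc_mult_mat[of A "dim_row A" "dim_row B" B "dim_row C" C "dim_col C"]) auto

lemma assoc_mult_mat_vec_dim:
  "dim_col A = dim_row B \<Longrightarrow> dim_col B = dim_vec v \<Longrightarrow> (A * B) *\<^sub>v v = A *\<^sub>v (B *\<^sub>v (v :: 'a::semiring_0 vec))"
  by (rule assoc_mult_mat_vec[of A "dim_row A" "dim_row B" B "dim_vec v"]) auto

lemma mat_eqI_mult_vec:
  fixes A B :: "'a::semiring_1 mat"
  assumes "A \<in> carrier_mat n m" "B \<in> carrier_mat n m"
    and "\<And>v. v \<in> carrier_vec m \<Longrightarrow> A *\<^sub>v v = B *\<^sub>v v"
  shows "A = B"
proof (rule eq_matI)
  fix i j assume ij: "i < dim_row B" "j < dim_col B"
  have "(A *\<^sub>v unit_vec m j) $ i = (B *\<^sub>v unit_vec m j) $ i"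
    by (simp add: assms(3))
  then show "A $$ (i, j) = B $$ (i, j)"
    using assms(1,2) ij by simp
qed (use assms in auto)

lemma index_mat_adjoint [simp]:
  fixes A :: "complex mat"
  shows "i < dim_col A \<Longrightarrow> j < dim_row A \<Longrightarrow> mat_adjoint A $$ (i, j) = cnj (A $$ (j, i))"
  by (auto simp: mat_adjoint_def mat_of_rows_def)

lemma mat_adjoint_adjoint [simp]: "mat_adjoint (mat_adjoint A) = (A :: complex mat)"
  by (rule eq_matI) auto

lemma mat_adjoint_mult:
  fixes A B :: "complex mat"
  assumes "A \<in> carrier_mat n m" "B \<in> carrier_mat m l"
  shows "mat_adjoint (A * B) = mat_adjoint B * mat_adjoint A"
  by (rule eq_matI) (use assms in \<open>auto simp: scalar_prod_def mult.commute intro!: sum.cong\<close>)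

lemma zero_matI_mult_vec:
  fixes A :: "complex mat"
  assumes A: "A \<in> carrier_mat n m" and "\<And>v. v \<in> carrier_vec m \<Longrightarrow> A *\<^sub>v v = 0\<^sub>v n"
  shows "A = 0\<^sub>m n m"
proof (rule eq_matI)
  fix i j assume ij: "i < dim_row (0\<^sub>m n m :: complex mat)" "j < dim_col (0\<^sub>m n m :: complex mat)"
  have "A $$ (i, j) = (A *\<^sub>v unit_vec m j) $ i"
    using A ij by simp
  then show "A $$ (i, j) = 0\<^sub>m n m $$ (i, j)"
    using assms(2)[of "unit_vec m j"] ij by simp
qed (use A in auto)

section \<open>Traces and eigenvalues\<close>

lemma trace_mult_commute:
  fixes A B :: "complex mat"
  assumes "A \<in> carrier_mat n m" "B \<in> carrier_mat m n"
  shows "(\<Sum>i<n. (A * B) $$ (i, i)) = (\<Sum>j<m. (B * A) $$ (j, j))"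
proof -
  have "(\<Sum>i<n. (A * B) $$ (i, i)) = (\<Sum>i<n. \<Sum>j<m. A $$ (i, j) * B $$ (j, i))"
    using assms by (auto simp: scalar_prod_def lessThan_atLeast0 intro!: sum.cong)
  also have "\<dots> = (\<Sum>j<m. \<Sum>i<n. B $$ (j, i) * A $$ (i, j))"
    by (subst sum.swap) (simp add: mult.commute)
  also have "\<dots> = (\<Sum>j<m. (B * A) $$ (j, j))"
    using assms by (auto simp: scalar_prod_def lessThan_atLeast0 intro!: sum.cong)
  finally show ?thesis .
qed

text \<open>The trace is the sum of the roots of the characteristic polynomial: a Schur form carries
  these roots on its diagonal, and the trace is invariant under similarity.\<close>

lemma trace_zero_of_eigenvalues_zero:
  fixes A :: "complex mat"
  assumes A: "A \<in> carrier_mat n n" and ev: "\<And>e. eigenvalue A e \<Longrightarrow> e = 0"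
  shows "(\<Sum>i<n. A $$ (i, i)) = 0"
proof -
  obtain es where es: "char_poly A = (\<Prod>e\<leftarrow>es. [:- e, 1:])"
    using char_poly_factorized[OF A] by blast
  obtain B P Q where schur: "schur_decomposition A es = (B, P, Q)"
    by (metis prod_cases3)
  have sim: "similar_mat_wit A B P Q" and diag: "diag_mat B = es"
    using schur_decomposition[OF A es schur] by auto
  have dim: "n = dim_row A"
    using A by simp
  have B: "B \<in> carrier_mat n n" "P \<in> carrier_mat n n" "Q \<in> carrier_mat n n"
    and QP: "Q * P = 1\<^sub>m n" and APBQ: "A = P * B * Q"
    by (rule similar_mat_witD[OF dim sim])+
  have "e = 0" if "e \<in> set es" for e
  proof (rule ev)
    have "poly (char_poly A) e = 0"
      using that by (auto simp: es poly_prod_list prod_list_zero_iff)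
    then show "eigenvalue A e"
      by (simp add: eigenvalue_root_char_poly[OF A])
  qed
  then have B0: "B $$ (i, i) = 0" if "i < n" for i
    using that B(1) by (simp add: diag[symmetric] diag_mat_def)
  have "(\<Sum>i<n. A $$ (i, i)) = (\<Sum>i<n. (P * (B * Q)) $$ (i, i))"
    using B by (simp only: APBQ assoc_mult_mat[of P n n B n Q n])
  also have "\<dots> = (\<Sum>i<n. ((B * Q) * P) $$ (i, i))"
    using B by (intro trace_mult_commute) auto
  also have "(B * Q) * P = B"
    using B by (simp add: assoc_mult_mat[of B n n Q n P n] QP)
  finally show ?thesis
    using B0 by simp
qed

text \<open>The trace of \<open>mat_adjoint A * A\<close> is the sum of the squared moduli of the
  entries of \<open>A\<close>, so once it vanishes every entry does.\<close>

lemma mat_zero_of_adjoint_mult_eigenvalues_zero: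
  fixes A :: "complex mat"
  assumes A: "A \<in> carrier_mat n m" and ev: "\<And>e. eigenvalue (mat_adjoint A * A) e \<Longrightarrow> e = 0"
  shows "A = 0\<^sub>m n m"
proof -
  have "complex_of_real (\<Sum>j<m. \<Sum>i<n. (cmod (A $$ (i, j)))\<^sup>2) = (\<Sum>j<m. (mat_adjoint A * A) $$ (j, j))"
    using A by (auto simp: scalar_prod_def lessThan_atLeast0 complex_norm_square mult.commute
        simp del: of_real_power intro!: sum.cong)
  also have "\<dots> = 0"
    using A ev by (intro trace_zero_of_eigenvalues_zero) auto
  finally have "(\<Sum>j<m. \<Sum>i<n. (cmod (A $$ (i, j)))\<^sup>2) = 0"
    using of_real_eq_0_iff by blast
  then have "A $$ (i, j) = 0" if "i < n" "j < m" for i j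
    using that by (simp add: sum_nonneg_eq_0_iff sum_nonneg)
  then show ?thesis
    using A by (intro eq_matI) auto
qed

section \<open>Isometries and orthogonal projections\<close>

lemma isometry_dim_le:
  fixes V :: "complex mat"
  assumes V: "V \<in> carrier_mat k m" "mat_adjoint V * V = 1\<^sub>m m"
  shows "m \<le> k"
proof (rule ccontr)
  assume "\<not> m \<le> k"
  then have km: "k < m" by simp
  \<comment> \<open>Padding \<open>V\<close> with zero rows gives a square isometry; it would be unitary despite its zero row.\<close>
  define W where "W = mat m m (\<lambda>(i, j). if i < k then V $$ (i, j) else 0)"
  have W: "W \<in> carrier_mat m m"
    by (simp add: W_def)
  have "mat_adjoint W * W = mat_adjoint V * V"
  proof (rule eq_matI)
    fix i j assume "i < dim_row (mat_adjoint V * V)" "j < dim_col (mat_adjoint V * V)"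
    then have ij: "i < m" "j < m"
      using V(1) by auto
    have "(mat_adjoint W * W) $$ (i, j) = (\<Sum>l = 0..<m. cnj (W $$ (l, i)) * W $$ (l, j))"
      using ij W by (auto simp: scalar_prod_def intro!: sum.cong)
    also have "\<dots> = (\<Sum>l = 0..<k. cnj (V $$ (l, i)) * V $$ (l, j))"
      using km ij by (intro sum.mono_neutral_cong_right) (auto simp: W_def)
    also have "\<dots> = (mat_adjoint V * V) $$ (i, j)"
      using ij V(1) by (auto simp: scalar_prod_def intro!: sum.cong)
    finally show "(mat_adjoint W * W) $$ (i, j) = (mat_adjoint V * V) $$ (i, j)" .
  qed (use V W in auto)
  then have "W * mat_adjoint W = 1\<^sub>m m"
    using mat_mult_left_right_inverse[of "mat_adjoint W" m W] W V(2) by simp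
  then have "(W * mat_adjoint W) $$ (k, k) = 1"
    using km by simp
  moreover have "(W * mat_adjoint W) $$ (k, k) = 0"
    using km by (simp add: scalar_prod_def W_def)
  ultimately show False by simp
qed

text \<open>Spells out the locale-based notion inside \<open>irreducible_representation\<close>, so
  that the matrix arguments carry no module structure.\<close>

definition vec_subspace :: "nat \<Rightarrow> complex vec set \<Rightarrow> bool" where
  "vec_subspace k W \<longleftrightarrow> W \<subseteq> carrier_vec k \<and> 0\<^sub>v k \<in> W \<and>
     (\<forall>v\<in>W. \<forall>w\<in>W. v + w \<in> W) \<and> (\<forall>c. \<forall>w\<in>W. c \<cdot>\<^sub>v w \<in> W)"

lemma subspace_iff_vec_subspace:
  "VectorSpace.subspace class_ring W (module_vec TYPE(complex) k) \<longleftrightarrow> vec_subspace k W"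
proof
  assume "VectorSpace.subspace class_ring W (module_vec TYPE(complex) k)"
  then have "submodule class_ring W (module_vec TYPE(complex) k)"
    by (simp add: VectorSpace.subspace_def)
  then show "vec_subspace k W"
    unfolding submodule_def vec_subspace_def
    by (auto simp: module_vec_simps class_ring_simps)
next
  assume "vec_subspace k W"
  then show "VectorSpace.subspace class_ring W (module_vec TYPE(complex) k)"
    unfolding VectorSpace.subspace_def submodule_def vec_subspace_def module_vec_simps
      class_ring_simps
    by (intro conjI vec_vs vec_module) auto
qed

text \<open>The columns of \<open>V\<close> are an orthonormal basis of \<open>W\<close>, and
  \<open>V * mat_adjoint V\<close> is the orthogonal projection onto \<open>W\<close>. Gram-Schmidt
  is run as an extremal argument: take an isometry into \<open>W\<close> with the most columns,
  their number being bounded by \<open>isometry_dim_le\<close>. A vector of \<open>W\<close> that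
  the projection moves would supply one more column.\<close>

lemma exists_isometry_onto_subspace:
  assumes W: "vec_subspace k W"
  obtains m and V :: "complex mat" where "V \<in> carrier_mat k m" "mat_adjoint V * V = 1\<^sub>m m"
    "\<And>w. w \<in> carrier_vec k \<Longrightarrow> V *\<^sub>v (mat_adjoint V *\<^sub>v w) \<in> W"
    "\<And>w. w \<in> W \<Longrightarrow> V *\<^sub>v (mat_adjoint V *\<^sub>v w) = w"
proof -
  define Q where "Q m \<longleftrightarrow> (\<exists>V \<in> carrier_mat k m. mat_adjoint V * V = 1\<^sub>m m \<and>
    (\<forall>v \<in> carrier_vec m. V *\<^sub>v v \<in> W))" for m :: nat
  have Wk: "W \<subseteq> carrier_vec k" and W0: "0\<^sub>v k \<in> W"
    and Wadd: "\<And>v w. v \<in> W \<Longrightarrow> w \<in> W \<Longrightarrow> v + w \<in> W"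
    and Wsmult: "\<And>c w. w \<in> W \<Longrightarrow> c \<cdot>\<^sub>v w \<in> W"
    using W by (auto simp: vec_subspace_def)
  have "Q 0"
    unfolding Q_def
  proof (intro bexI conjI ballI)
    show "0\<^sub>m k 0 *\<^sub>v v \<in> W" if "v \<in> carrier_vec 0" for v :: "complex vec"
    proof -
      have "0\<^sub>m k 0 *\<^sub>v v = 0\<^sub>v k"
        using that by (intro eq_vecI) (auto simp: scalar_prod_def)
      then show ?thesis using W0 by simp
    qed
  qed auto
  moreover have "\<forall>m. Q m \<longrightarrow> m \<le> k"
    unfolding Q_def using isometry_dim_le by blast
  ultimately obtain m where "Q m" and max: "\<And>m'. Q m' \<Longrightarrow> m' \<le> m"
    using ex_has_greatest_nat[of Q 0 "\<lambda>m. m" "Suc k"] by (auto simp: less_Suc_eq_le)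
  then obtain V where V: "V \<in> carrier_mat k m" "mat_adjoint V * V = 1\<^sub>m m"
      "\<And>v. v \<in> carrier_vec m \<Longrightarrow> V *\<^sub>v v \<in> W"
    unfolding Q_def by blast
  have dimV [simp]: "dim_row V = k" "dim_col V = m"
    using V by auto
  have VV: "V *\<^sub>v (mat_adjoint V *\<^sub>v w) \<in> W" if "w \<in> carrier_vec k" for w
    using V(1) by (intro V(3)) simp
  have "V *\<^sub>v (mat_adjoint V *\<^sub>v w) = w" if w: "w \<in> W" for w
  proof (rule ccontr)
    assume neq: "V *\<^sub>v (mat_adjoint V *\<^sub>v w) \<noteq> w"
    have wk: "w \<in> carrier_vec k"
      using w Wk by auto
    define p where "p = V *\<^sub>v (mat_adjoint V *\<^sub>v w)"
    \<comment> \<open>The part of \<open>w\<close> orthogonal to the columns of \<open>V\<close>;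
      normalised to \<open>u\<close>, it becomes the additional column.\<close>
    define r where "r = w + (-1) \<cdot>\<^sub>v p"
    have p: "p \<in> W" "p \<in> carrier_vec k"
      using VV wk Wk by (auto simp: p_def)
    have r: "r \<in> W" "r \<in> carrier_vec k"
      using Wadd Wsmult w p Wk by (auto simp: r_def)
    have "mat_adjoint V *\<^sub>v p = (mat_adjoint V * V) *\<^sub>v (mat_adjoint V *\<^sub>v w)"
      unfolding p_def using V(1) wk by (subst assoc_mult_mat_vec[of _ m k _ m]) auto
    also have "\<dots> = mat_adjoint V *\<^sub>v w"
      using V wk by simp
    finally have Vp: "mat_adjoint V *\<^sub>v p = mat_adjoint V *\<^sub>v w" .
    have "mat_adjoint V *\<^sub>v r = mat_adjoint V *\<^sub>v w + (-1) \<cdot>\<^sub>v (mat_adjoint V *\<^sub>v p)"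
      unfolding r_def using V(1) wk p
      by (subst mult_add_distrib_mat_vec[of _ m k]) (auto simp: mult_mat_vec[of _ m k])
    also have "\<dots> = 0\<^sub>v m"
      unfolding Vp using V(1) by (intro eq_vecI) auto
    finally have Vr: "mat_adjoint V *\<^sub>v r = 0\<^sub>v m" .
    have orth: "(\<Sum>l<k. cnj (V $$ (l, i)) * r $ l) = 0" if "i < m" for i
    proof -
      have "(mat_adjoint V *\<^sub>v r) $ i = (\<Sum>l<k. cnj (V $$ (l, i)) * r $ l)"
        using that V(1) r by (auto simp: scalar_prod_def lessThan_atLeast0 intro!: sum.cong)
      then show ?thesis
        using Vr that by simp
    qed
    have "r \<noteq> 0\<^sub>v k"
    proof
      assume r0: "r = 0\<^sub>v k"
      have "p = w"
      proof (rule eq_vecI)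
        fix i assume "i < dim_vec w"
        then show "p $ i = w $ i"
          using arg_cong[OF r0, of "\<lambda>v. v $ i"] wk p by (auto simp: r_def)
      qed (use p wk in auto)
      then show False using neq by (simp add: p_def)
    qed
    then obtain l0 where l0: "l0 < k" "r $ l0 \<noteq> 0"
      using r(2) by (metis eq_vecI carrier_vecD index_zero_vec)
    define s where "s = sqrt (\<Sum>l<k. (cmod (r $ l))\<^sup>2)"
    have pos: "(\<Sum>l<k. (cmod (r $ l))\<^sup>2) > 0"
      using l0 by (intro sum_pos2[of _ l0]) auto
    then have s: "s \<noteq> 0" "complex_of_real s * complex_of_real s = (\<Sum>l<k. cnj (r $ l) * r $ l)"
      unfolding s_def
      by (auto simp flip: of_real_mult simp: complex_norm_square mult.commute simp del: of_real_power)
    define u where "u = complex_of_real (1 / s) \<cdot>\<^sub>v r"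
    have u: "u \<in> W" "u \<in> carrier_vec k"
      using Wsmult r by (auto simp: u_def)
    have Vu: "(\<Sum>l<k. cnj (V $$ (l, i)) * u $ l) = 0" if "i < m" for i
    proof -
      have "(\<Sum>l<k. cnj (V $$ (l, i)) * u $ l) = complex_of_real (1 / s) * (\<Sum>l<k. cnj (V $$ (l, i)) * r $ l)"
        using r by (auto simp: u_def sum_distrib_left intro!: sum.cong)
      then show ?thesis using orth[OF that] by simp
    qed
    have uV: "(\<Sum>l<k. cnj (u $ l) * V $$ (l, i)) = 0" if "i < m" for i
      using arg_cong[OF Vu[OF that], of cnj] by (simp add: mult.commute)
    have uu: "(\<Sum>l<k. cnj (u $ l) * u $ l) = 1"
    proof -
      have "(\<Sum>l<k. cnj (u $ l) * u $ l)
          = complex_of_real (1 / s) * complex_of_real (1 / s) * (\<Sum>l<k. cnj (r $ l) * r $ l)"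
        using r by (auto simp: u_def sum_distrib_left intro!: sum.cong)
      also have "\<dots> = 1"
        unfolding s(2)[symmetric] using s(1) by simp
      finally show ?thesis .
    qed
    define V' where "V' = mat k (Suc m) (\<lambda>(i, j). if j < m then V $$ (i, j) else u $ i)"
    have V': "V' \<in> carrier_mat k (Suc m)"
      by (simp add: V'_def)
    have "mat_adjoint V' * V' = 1\<^sub>m (Suc m)"
    proof (rule eq_matI)
      fix i j assume "i < dim_row (1\<^sub>m (Suc m) :: complex mat)" "j < dim_col (1\<^sub>m (Suc m) :: complex mat)"
      then have ij: "i < Suc m" "j < Suc m" by auto
      have *: "(mat_adjoint V' * V') $$ (i, j) = (\<Sum>l<k. cnj (V' $$ (l, i)) * V' $$ (l, j))"
        using ij V' by (auto simp: scalar_prod_def lessThan_atLeast0 intro!: sum.cong)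
      have VV: "(\<Sum>l<k. cnj (V $$ (l, i)) * V $$ (l, j)) = 1\<^sub>m m $$ (i, j)" if "i < m" "j < m"
        unfolding V(2)[symmetric]
        using that V(1) by (auto simp: scalar_prod_def lessThan_atLeast0 intro!: sum.cong)
      show "(mat_adjoint V' * V') $$ (i, j) = 1\<^sub>m (Suc m) $$ (i, j)"
        unfolding * using ij VV Vu uV uu by (auto simp: V'_def less_Suc_eq)
    qed (use V' in auto)
    moreover have "V' *\<^sub>v v \<in> W" if v: "v \<in> carrier_vec (Suc m)" for v
    proof -
      have "V' *\<^sub>v v = V *\<^sub>v vec m (\<lambda>i. v $ i) + (v $ m) \<cdot>\<^sub>v u"
        using V(1) V' u v
        by (intro eq_vecI) (auto simp: scalar_prod_def V'_def lessThan_atLeast0[symmetric])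
      then show ?thesis
        using Wadd Wsmult V(3) u by auto
    qed
    ultimately have "Q (Suc m)"
      unfolding Q_def using V' by blast
    then show False using max by fastforce
  qed
  then show ?thesis
    using that V(1,2) VV by blast
qed

section \<open>Irreducible finite dimensional representations\<close>

lemma fd_representationD:
  assumes "fd_representation k \<pi>"
  shows "\<pi> a \<in> carrier_mat k k" "\<pi> (a + b) = \<pi> a + \<pi> b" "\<pi> (c *\<^sub>C a) = c \<cdot>\<^sub>m \<pi> a"
    "\<pi> (a * b) = \<pi> a * \<pi> b" "\<pi> (star a) = mat_adjoint (\<pi> a)"
    "dim_row (\<pi> a) = k" "dim_col (\<pi> a) = k"
  using assms unfolding fd_representation_def by blast+

lemma fd_representation_diff:
  assumes "fd_representation k \<pi>"
  shows "\<pi> (a - b) = \<pi> a - \<pi> b"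
proof -
  have "\<pi> (a - b) + \<pi> b = \<pi> a"
    using fd_representationD(2)[OF assms, of "a - b" b] by simp
  then show ?thesis
    using fd_representationD(6,7)[OF assms] by (simp flip: \<open>\<pi> (a - b) + \<pi> b = \<pi> a\<close>) (intro eq_matI; simp)
qed

text \<open>The hypothesis \<open>inv\<close> expresses that the range of \<open>V\<close> is
  invariant. Hence in a product of two compressions the inner factor
  \<open>V * mat_adjoint V\<close> acts as the identity on the range of \<open>\<pi> b * V\<close>,
  which gives multiplicativity.\<close>

lemma fd_representation_compress:
  fixes V :: "complex mat"
  assumes \<pi>: "fd_representation k \<pi>" and V: "V \<in> carrier_mat k m" "mat_adjoint V * V = 1\<^sub>m m"
    and inv: "\<And>a. V * (mat_adjoint V * (\<pi> a * V)) = \<pi> a * V"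
  shows "fd_representation m (\<lambda>a. mat_adjoint V * (\<pi> a * V))"
proof -
  note D = fd_representationD[OF \<pi>]
  note [simp] = D(6,7)
  have dimV [simp]: "dim_row V = k" "dim_col V = m"
    using V by auto
  show ?thesis
    unfolding fd_representation_def
  proof (intro conjI allI)
    fix a b :: 'a and c :: complex
    show "mat_adjoint V * (\<pi> a * V) \<in> carrier_mat m m"
      by (auto intro!: carrier_matI)
    show "mat_adjoint V * (\<pi> (a + b) * V) = mat_adjoint V * (\<pi> a * V) + mat_adjoint V * (\<pi> b * V)"
      by (simp add: D(2) add_mult_distrib_mat[OF D(1) D(1) V(1)]
          mult_add_distrib_mat[of _ m k _ m] mult_carrier_mat[OF D(1) V(1)] V(1))
    show "mat_adjoint V * (\<pi> (c *\<^sub>C a) * V) = c \<cdot>\<^sub>m (mat_adjoint V * (\<pi> a * V))"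
      by (simp add: D(3) mult_smult_assoc_mat[OF D(1) V(1)]
          mult_smult_distrib[of _ m k _ m] mult_carrier_mat[OF D(1) V(1)] V(1))
    show "mat_adjoint V * (\<pi> (a * b) * V) = mat_adjoint V * (\<pi> a * V) * (mat_adjoint V * (\<pi> b * V))"
      by (simp add: D(4) assoc_mult_mat_dim inv)
    show "mat_adjoint V * (\<pi> (star a) * V) = mat_adjoint (mat_adjoint V * (\<pi> a * V))"
      by (simp add: D(5) assoc_mult_mat_dim V(1) D(1) mult_carrier_mat[OF D(1) V(1)]
          mat_adjoint_mult[of _ m k _ m] mat_adjoint_mult[of _ k k _ m])
  qed
qed

text \<open>The compression of a representation to an invariant subspace has smaller dimension.\<close>

lemma minimal_representation_kills_invariant_subspace:
  assumes \<pi>: "fd_representation k \<pi>"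
    and min: "\<And>m \<rho>. m < k \<Longrightarrow> fd_representation m \<rho> \<Longrightarrow> \<rho> a = 0\<^sub>m m m"
    and W: "vec_subspace k W" "\<And>b w. w \<in> W \<Longrightarrow> \<pi> b *\<^sub>v w \<in> W" "W \<noteq> carrier_vec k"
    and w: "w \<in> W"
  shows "\<pi> a *\<^sub>v w = 0\<^sub>v k"
proof -
  note D = fd_representationD[OF \<pi>]
  note [simp] = D(6,7)
  obtain m and V :: "complex mat" where V: "V \<in> carrier_mat k m" "mat_adjoint V * V = 1\<^sub>m m"
    and VW: "\<And>w. w \<in> carrier_vec k \<Longrightarrow> V *\<^sub>v (mat_adjoint V *\<^sub>v w) \<in> W"
    and VVw: "\<And>w. w \<in> W \<Longrightarrow> V *\<^sub>v (mat_adjoint V *\<^sub>v w) = w"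
    by (rule exists_isometry_onto_subspace[OF W(1)]) (rule that, assumption+)
  have dimV [simp]: "dim_row V = k" "dim_col V = m"
    using V by auto
  have Wk: "W \<subseteq> carrier_vec k"
    using W(1) by (simp add: vec_subspace_def)
  \<comment> \<open>A square isometry is unitary, and then \<open>VW\<close> puts every vector into
    \<open>W\<close>.\<close>
  have "m \<noteq> k"
  proof
    assume "m = k"
    then have "V * mat_adjoint V = 1\<^sub>m k"
      using V mat_mult_left_right_inverse[of "mat_adjoint V" k V] by simp
    then have "w \<in> W" if "w \<in> carrier_vec k" for w
      using VW[OF that] that by (simp flip: assoc_mult_mat_vec_dim)
    then show False using W(3) Wk by auto
  qed
  then have mk: "m < k"
    using isometry_dim_le[OF V] by simp
  have VvW: "V *\<^sub>v v \<in> W" if "v \<in> carrier_vec m" for v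
  proof -
    have "V *\<^sub>v (mat_adjoint V *\<^sub>v (V *\<^sub>v v)) = V *\<^sub>v ((mat_adjoint V * V) *\<^sub>v v)"
      using that by (simp add: assoc_mult_mat_vec_dim)
    also have "\<dots> = V *\<^sub>v v"
      using that by (simp add: V(2))
    finally show ?thesis
      using VW[of "V *\<^sub>v v"] V(1) that by simp
  qed
  have inv: "V * (mat_adjoint V * (\<pi> b * V)) = \<pi> b * V" for b
  proof (rule mat_eqI_mult_vec[of _ k m])
    fix v :: "complex vec" assume v: "v \<in> carrier_vec m"
    show "V * (mat_adjoint V * (\<pi> b * V)) *\<^sub>v v = \<pi> b * V *\<^sub>v v"
      using v VVw[OF W(2)[OF VvW[OF v]]] by (simp add: assoc_mult_mat_vec_dim)
  qed (auto intro!: carrier_matI)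
  \<comment> \<open>By \<open>inv\<close>, \<open>\<pi> a * V\<close> is \<open>V\<close> times this
    compression, so it vanishes as well.\<close>
  have "mat_adjoint V * (\<pi> a * V) = 0\<^sub>m m m"
    by (rule min[OF mk fd_representation_compress[OF \<pi> V inv]])
  then have "\<pi> a * V = 0\<^sub>m k m"
    using inv[of a] V(1) by simp
  then have "(\<pi> a * V) *\<^sub>v (mat_adjoint V *\<^sub>v w) = 0\<^sub>v k"
    using V(1) by (intro eq_vecI) auto
  moreover have "(\<pi> a * V) *\<^sub>v (mat_adjoint V *\<^sub>v w) = \<pi> a *\<^sub>v w"
    using VVw[OF w] by (simp add: assoc_mult_mat_vec_dim)
  ultimately show ?thesis by simp
qed

text \<open>If \<open>W\<close> is invariant, non-zero and proper, then its orthogonal complement is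
  also invariant and proper. By minimality \<open>\<pi> a\<close> kills both, hence their sum, which
  is the whole space, against \<open>nz\<close>.\<close>

lemma irreducible_of_minimal:
  assumes \<pi>: "fd_representation k \<pi>" and nz: "\<pi> a \<noteq> 0\<^sub>m k k"
    and min: "\<And>m \<rho>. m < k \<Longrightarrow> fd_representation m \<rho> \<Longrightarrow> \<rho> a = 0\<^sub>m m m"
  shows "irreducible_representation k \<pi>"
proof -
  note D = fd_representationD[OF \<pi>]
  note [simp] = D(6,7)
  have "W = {0\<^sub>v k} \<or> W = carrier_vec k"
    if W: "vec_subspace k W" and Winv: "\<And>b w. w \<in> W \<Longrightarrow> \<pi> b *\<^sub>v w \<in> W" for W
  proof (rule ccontr)
    assume "\<not> (W = {0\<^sub>v k} \<or> W = carrier_vec k)"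
    then have neq: "W \<noteq> {0\<^sub>v k}" "W \<noteq> carrier_vec k" by auto
    obtain m and V :: "complex mat" where V: "V \<in> carrier_mat k m" "mat_adjoint V * V = 1\<^sub>m m"
      and VW: "\<And>w. w \<in> carrier_vec k \<Longrightarrow> V *\<^sub>v (mat_adjoint V *\<^sub>v w) \<in> W"
      and VVw: "\<And>w. w \<in> W \<Longrightarrow> V *\<^sub>v (mat_adjoint V *\<^sub>v w) = w"
      by (rule exists_isometry_onto_subspace[OF W]) (rule that, assumption+)
    have dimV [simp]: "dim_row V = k" "dim_col V = m"
      using V by auto
    have Wk: "W \<subseteq> carrier_vec k" and W0: "0\<^sub>v k \<in> W"
      using W by (auto simp: vec_subspace_def)
    have V0: "A *\<^sub>v 0\<^sub>v j = 0\<^sub>v i" if "A \<in> carrier_mat i j" for A :: "complex mat" and i j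
      using that by (intro eq_vecI) auto
    \<comment> \<open>\<open>P\<close> is the orthogonal projection onto \<open>W\<close>, so its
      kernel \<open>W'\<close> is the orthogonal complement.\<close>
    define P where "P w = V *\<^sub>v (mat_adjoint V *\<^sub>v w)" for w
    define W' where "W' = {w \<in> carrier_vec k. P w = 0\<^sub>v k}"
    have Pk: "P w \<in> carrier_vec k" if "w \<in> carrier_vec k" for w
      using VW[OF that] Wk by (auto simp: P_def)
    have Padd: "P (v + w) = P v + P w" if "v \<in> carrier_vec k" "w \<in> carrier_vec k" for v w
      using that V(1)
      by (simp add: P_def mult_add_distrib_mat_vec[of "mat_adjoint V" m k] mult_add_distrib_mat_vec[of V k m])
    have Psmult: "P (c \<cdot>\<^sub>v w) = c \<cdot>\<^sub>v P w" if "w \<in> carrier_vec k" for c w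
      using that V(1)
      by (simp add: P_def mult_mat_vec[of "mat_adjoint V" m k] mult_mat_vec[of V k m])
    have W': "vec_subspace k W'"
    proof -
      have "P (0\<^sub>v k) = 0\<^sub>v k"
        using V0[of "mat_adjoint V" m k] V0[of V k m] V(1) by (simp add: P_def)
      moreover have "c \<cdot>\<^sub>v 0\<^sub>v k = 0\<^sub>v k" for c :: complex
        by (intro eq_vecI) auto
      ultimately show ?thesis
        unfolding vec_subspace_def W'_def by (simp add: Padd Psmult subset_eq)
    qed
    have W'neq: "W' \<noteq> carrier_vec k"
    proof
      assume "W' = carrier_vec k"
      then have "w = 0\<^sub>v k" if "w \<in> W" for w
      proof -
        have "w \<in> W'"
          using that Wk \<open>W' = carrier_vec k\<close> by auto
        then have "P w = 0\<^sub>v k"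
          by (simp add: W'_def)
        then show ?thesis
          using VVw[OF that] by (simp add: P_def)
      qed
      then show False
        using neq W0 by blast
    qed
    have inv: "V * (mat_adjoint V * (\<pi> b * (V * mat_adjoint V))) = \<pi> b * (V * mat_adjoint V)" for b
    proof (rule mat_eqI_mult_vec[of _ k k])
      fix v :: "complex vec" assume v: "v \<in> carrier_vec k"
      show "V * (mat_adjoint V * (\<pi> b * (V * mat_adjoint V))) *\<^sub>v v = \<pi> b * (V * mat_adjoint V) *\<^sub>v v"
        using v VVw[OF Winv[OF VW[OF v]]] by (simp add: assoc_mult_mat_vec_dim)
    qed (auto intro!: carrier_matI)
    \<comment> \<open>Only here does the involution enter: invariance of \<open>W\<close> under
      \<open>\<pi> (star b)\<close> reads
      \<open>A * (\<pi> (star b) * A) = \<pi> (star b) * A\<close> for the self-adjoint projection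
      \<open>A\<close>, and the adjoint of this equation is the claim. It makes the kernel of the
      projection invariant under \<open>\<pi> b\<close>.\<close>
    have commute: "V * (mat_adjoint V * \<pi> b) = V * (mat_adjoint V * (\<pi> b * (V * mat_adjoint V)))" for b
    proof -
      define A where "A = V * mat_adjoint V"
      have A: "A \<in> carrier_mat k k" "mat_adjoint A = A"
        using V(1) by (auto simp: A_def mat_adjoint_mult[of _ k m _ k])
      have "A * (\<pi> (star b) * A) = \<pi> (star b) * A"
        using inv[of "star b"] by (simp add: A_def assoc_mult_mat_dim)
      then have "mat_adjoint (A * (\<pi> (star b) * A)) = mat_adjoint (\<pi> (star b) * A)"
        by simp
      then have "A * \<pi> b * A = A * \<pi> b"
        using A D(1) by (simp add: mat_adjoint_mult[of _ k k _ k] mult_carrier_mat[of _ k k _ k] D(5))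
      then show ?thesis
        by (simp add: A_def assoc_mult_mat_dim)
    qed
    have W'inv: "\<pi> b *\<^sub>v w \<in> W'" if w: "w \<in> W'" for b w
    proof -
      have wk: "w \<in> carrier_vec k" and Pw: "P w = 0\<^sub>v k"
        using w by (auto simp: W'_def)
      have bw: "\<pi> b *\<^sub>v w \<in> carrier_vec k"
        using D(1) wk by simp
      have "P (\<pi> b *\<^sub>v w) = (V * (mat_adjoint V * \<pi> b)) *\<^sub>v w"
        using wk by (simp add: P_def assoc_mult_mat_vec_dim)
      also have "\<dots> = P (\<pi> b *\<^sub>v P w)"
        unfolding commute using wk by (simp add: P_def assoc_mult_mat_vec_dim)
      also have "\<dots> = P (\<pi> b *\<^sub>v 0\<^sub>v k)"
        by (simp only: Pw)
      also have "\<dots> = 0\<^sub>v k"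
        unfolding P_def using V(1) D(1)[of b]
        by (simp add: V0[of "\<pi> b" k k] V0[of "mat_adjoint V" m k] V0[of V k m])
      finally show ?thesis
        using bw by (simp add: W'_def)
    qed
    have "\<pi> a *\<^sub>v w = 0\<^sub>v k" if w: "w \<in> carrier_vec k" for w
    proof -
      have PP: "P (P w) = P w"
        using VVw[OF VW[OF w]] by (simp add: P_def)
      define r where "r = w + (-1) \<cdot>\<^sub>v P w"
      have r: "r \<in> carrier_vec k"
        using w Pk by (simp add: r_def)
      have "P r = P w + (-1) \<cdot>\<^sub>v P w"
        using w Pk by (simp add: r_def Padd Psmult PP)
      also have "\<dots> = 0\<^sub>v k"
        using Pk[OF w] by (intro eq_vecI) auto
      finally have "r \<in> W'"
        using r by (simp add: W'_def)
      then have "\<pi> a *\<^sub>v r = 0\<^sub>v k"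
        by (intro minimal_representation_kills_invariant_subspace[OF \<pi> _ W' W'inv W'neq]) (rule min)
      moreover have "\<pi> a *\<^sub>v P w = 0\<^sub>v k"
        unfolding P_def
        by (rule minimal_representation_kills_invariant_subspace[OF \<pi> min W Winv neq(2) VW[OF w]])
      moreover have "w = P w + r"
        using w Pk[OF w] by (intro eq_vecI) (auto simp: r_def)
      ultimately show ?thesis
        using Pk[OF w] r D(1)[of a] mult_add_distrib_mat_vec[of "\<pi> a" k k "P w" r] by simp
    qed
    then show False
      using zero_matI_mult_vec[OF D(1)] nz by blast
  qed
  then show ?thesis
    unfolding irreducible_representation_def subspace_iff_vec_subspace using \<pi> nz by blast
qed

section \<open>Subspaces of finite codimension\<close>

text \<open>For a two-sided ideal of a ring this is primeness, except that the whole ring is not excluded.\<close>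

definition prime_set :: "'a::semigroup_mult set \<Rightarrow> bool" where
  "prime_set P \<longleftrightarrow> (\<forall>x y. (\<forall>a. x * a * y \<in> P) \<longrightarrow> x \<in> P \<or> y \<in> P)"

text \<open>Phrased with representatives in the algebra, so that no quotient space has to be built;
  the dimension of the intersection with \<open>cspan B\<close> takes over the role of the dimension
  modulo \<open>I\<close>.\<close>

definition finite_codim :: "'a::cstar_algebra set \<Rightarrow> bool" where
  "finite_codim I \<longleftrightarrow> (\<exists>B. finite B \<and> (\<forall>a. \<exists>b\<in>cspan B. a - b \<in> I))"

text \<open>Above \<open>I\<close>, a strict inclusion is already visible inside
  \<open>cspan B\<close>: an element of \<open>M\<close> outside \<open>L\<close> differs by an
  element of \<open>I\<close> from some \<open>b\<close> in \<open>cspan B\<close>, and this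
  \<open>b\<close> is again in \<open>M\<close> and outside \<open>L\<close>. It enlarges a basis of
  \<open>L \<inter> cspan B\<close>.\<close>

lemma dim_Int_span_less:
  fixes I :: "'a::cstar_algebra set"
  assumes B: "finite B" "\<And>a. \<exists>b\<in>cspan B. a - b \<in> I"
    and L: "csubspace L" "I \<subseteq> L" and M: "csubspace M" "L \<subset> M"
  shows "complex_vector.dim (L \<inter> cspan B) < complex_vector.dim (M \<inter> cspan B)"
proof -
  obtain x where x: "x \<in> M" "x \<notin> L"
    using M by auto
  obtain b where b: "b \<in> cspan B" "x - b \<in> I"
    using B(2) by blast
  have bM: "b \<in> M"
    using complex_vector.subspace_diff[OF M(1) x(1), of "x - b"] b L M by auto
  have bL: "b \<notin> L"
    using complex_vector.subspace_add[OF L(1), of "x - b" b] b L x by auto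
  obtain C where C: "C \<subseteq> L \<inter> cspan B" "complex_vector.independent C"
      "L \<inter> cspan B \<subseteq> cspan C" "card C = complex_vector.dim (L \<inter> cspan B)"
    by (rule complex_vector.basis_exists)
  have "cspan C \<subseteq> L"
    using C(1) L(1) by (intro complex_vector.span_minimal) auto
  then have ind: "complex_vector.independent (insert b C)"
    using bL C(2) complex_vector.independent_insertI by blast
  have finC: "finite C"
    using complex_vector.independent_span_bound[OF B(1) C(2)] C(1) by auto
  have bC: "b \<notin> C"
    using bL C(1) by auto
  obtain E where E: "insert b C \<subseteq> E" "E \<subseteq> M \<inter> cspan B" "complex_vector.independent E"
      "M \<inter> cspan B \<subseteq> cspan E"
    using complex_vector.maximal_independent_subset_extend[OF _ ind, of "M \<inter> cspan B"] C(1) M bM b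
    by blast
  have finE: "finite E"
    using complex_vector.independent_span_bound[OF B(1) E(3)] E(2) by auto
  have "card (insert b C) \<le> card E"
    using E finE card_mono by blast
  also have "card E = complex_vector.dim (M \<inter> cspan B)"
    using complex_vector.basis_card_eq_dim[OF E(2) E(4) E(3)] .
  finally show ?thesis
    using finC bC C(4) by simp
qed

section \<open>Prime ideals above a set of finite codimension\<close>

text \<open>If \<open>x\<close> lies in \<open>K\<close> but not in \<open>P\<close>, then for each
  \<open>y\<close> in the intersection of the other members all products \<open>x * a * y\<close>
  lie in every member, hence in \<open>P\<close>; primeness then puts \<open>y\<close> into
  \<open>P\<close>.\<close>

lemma prime_set_Inter_subset:
  fixes P :: "'a::semigroup_mult set"
  assumes "finite S" "S \<noteq> {}" "prime_set P"
    and "\<And>K x a. K \<in> S \<Longrightarrow> x \<in> K \<Longrightarrow> x * a \<in> K \<and> a * x \<in> K"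
    and "\<Inter>S \<subseteq> P"
  shows "\<exists>K\<in>S. K \<subseteq> P"
  using assms
proof (induction S rule: finite_ne_induct)
  case (insert K S)
  show ?case
  proof (cases "K \<subseteq> P")
    case False
    then obtain x where x: "x \<in> K" "x \<notin> P"
      by auto
    have "y \<in> P" if y: "y \<in> \<Inter>S" for y
    proof -
      have "x * a * y \<in> \<Inter>(insert K S)" for a
        using insert.prems(2)[of K x "a * y"] insert.prems(2)[of _ y "x * a"] x(1) y
        by (auto simp: mult.assoc)
      then show ?thesis
        using insert.prems(1,3) x(2) unfolding prime_set_def by blast
    qed
    then have "\<Inter>S \<subseteq> P"
      by blast
    then have "\<exists>K\<in>S. K \<subseteq> P"
      using insert.IH insert.prems(1,2) by (metis insert_iff)
    then show ?thesis by blast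
  qed auto
qed auto

text \<open>From an infinite \<open>T\<close>, one extremal choice produces a prime \<open>N\<close>
  that is the intersection of every infinite subfamily of some \<open>T0\<close>. A second one shows
  that \<open>N\<close> is already the intersection of finitely many members different from
  \<open>N\<close>. As \<open>N\<close> is prime, it contains one of these, and so equals it: a
  contradiction.\<close>

lemma finite_prime_ideals_above:
  fixes I :: "'a::cstar_algebra set"
  assumes I: "finite_codim I"
    and sub: "\<And>K. K \<in> T \<Longrightarrow> csubspace K"
    and ideal: "\<And>K x a. K \<in> T \<Longrightarrow> x \<in> K \<Longrightarrow> x * a \<in> K \<and> a * x \<in> K"
    and prime: "\<And>K. K \<in> T \<Longrightarrow> prime_set K"
    and above: "\<And>K. K \<in> T \<Longrightarrow> I \<subseteq> K"
  shows "finite T"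
proof (rule ccontr)
  assume inf: "infinite T"
  obtain B where B: "finite B" "\<And>a. \<exists>b\<in>cspan B. a - b \<in> I"
    using I unfolding finite_codim_def by auto
  define d where "d S = complex_vector.dim (\<Inter>S \<inter> cspan B)" for S
  have d_bound: "d S \<le> card B" for S
    unfolding d_def by (intro complex_vector.dim_le_card B) auto
  have d_less: "d S < d S'" if "S \<subseteq> T" "S' \<subseteq> T" "\<Inter>S \<subset> \<Inter>S'" for S S'
    unfolding d_def
  proof (rule dim_Int_span_less[OF B _ _ _ that(3)])
    show "csubspace (\<Inter>S)" "csubspace (\<Inter>S')"
      using that sub by (auto intro!: complex_vector.subspace_Inter)
    show "I \<subseteq> \<Inter>S"
      using that(1) above by (meson Inter_greatest subsetD)
  qed
  \<comment> \<open>Maximality of \<open>\<Inter>T0\<close> makes all infinite subfamilies of \<open>T0\<close> have the same intersection,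
    so that this intersection is prime by the pigeonhole principle.\<close>
  obtain T0 where T0: "T0 \<subseteq> T" "infinite T0"
    and max: "\<And>S. S \<subseteq> T \<Longrightarrow> infinite S \<Longrightarrow> d S \<le> d T0"
  proof -
    have "\<exists>S. (S \<subseteq> T \<and> infinite S) \<and> (\<forall>S'. S' \<subseteq> T \<and> infinite S' \<longrightarrow> d S' \<le> d S)"
      by (rule ex_has_greatest_nat[of _ T _ "Suc (card B)"]) (use inf d_bound in \<open>simp_all add: less_Suc_eq_le\<close>)
    then show ?thesis
      using that by meson
  qed
  define N where "N = \<Inter>T0"
  have Inter_N: "\<Inter>S = N" if S: "S \<subseteq> T0" "infinite S" for S
  proof (rule ccontr)
    assume "\<Inter>S \<noteq> N"
    then have "\<Inter>T0 \<subset> \<Inter>S"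
      using Inter_anti_mono[OF S(1)] by (simp add: N_def psubset_eq eq_commute)
    then have "d T0 < d S"
      using d_less S(1) T0(1) by (meson subset_trans)
    then show False
      using max[of S] S T0(1) by (meson leD subset_trans)
  qed
  have prime_N: "prime_set N"
    unfolding prime_set_def
  proof (intro allI impI)
    fix x y assume xy: "\<forall>a. x * a * y \<in> N"
    have "T0 = {K\<in>T0. x \<in> K} \<union> {K\<in>T0. y \<in> K}"
    proof (intro equalityI subsetI)
      fix K assume K: "K \<in> T0"
      then have "\<forall>a. x * a * y \<in> K"
        using xy by (simp add: N_def)
      then show "K \<in> {K\<in>T0. x \<in> K} \<union> {K\<in>T0. y \<in> K}"
        using prime[of K] T0(1) K unfolding prime_set_def by (metis (lifting) UnI1 UnI2 mem_Collect_eq subsetD)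
    qed auto
    then consider "infinite {K\<in>T0. x \<in> K}" | "infinite {K\<in>T0. y \<in> K}"
      using T0(2) by (metis (lifting) infinite_Un)
    then show "x \<in> N \<or> y \<in> N"
    proof cases
      case 1
      then show ?thesis using Inter_N[of "{K\<in>T0. x \<in> K}"] by blast
    next
      case 2
      then show ?thesis using Inter_N[of "{K\<in>T0. y \<in> K}"] by blast
    qed
  qed
  \<comment> \<open>\<open>N\<close> may itself belong to \<open>T0\<close>; dropping one member
    leaves an infinite subfamily, whose intersection is still \<open>N\<close>.\<close>
  define T1 where "T1 = T0 - {N}"
  have T1: "T1 \<subseteq> T" "infinite T1" and Inter_T1: "\<Inter>T1 = N"
    using T0 Inter_N[of T1] by (auto simp: T1_def)
  obtain K0 where K0: "K0 \<in> T1"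
    using T1(2) by (metis ex_in_conv finite.emptyI)
  obtain S where S: "finite S" "S \<noteq> {}" "S \<subseteq> T1"
    and min: "\<And>S'. finite S' \<Longrightarrow> S' \<noteq> {} \<Longrightarrow> S' \<subseteq> T1 \<Longrightarrow> d S \<le> d S'"
  proof -
    have "\<exists>S. (finite S \<and> S \<noteq> {} \<and> S \<subseteq> T1) \<and>
        (\<forall>S'. finite S' \<and> S' \<noteq> {} \<and> S' \<subseteq> T1 \<longrightarrow> d S \<le> d S')"
      by (rule ex_has_least_nat[of _ "{K0}"]) (use K0 in simp)
    then show ?thesis
      using that by meson
  qed
  \<comment> \<open>Adding \<open>K\<close> to \<open>S\<close> cannot shrink the intersection,
    since that would lower the minimal value \<open>d S\<close>.\<close>
  have "\<Inter>S \<subseteq> K" if K: "K \<in> T1" for K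
  proof -
    have "\<not> \<Inter>(insert K S) \<subset> \<Inter>S"
      using d_less[of "insert K S" S] min[of "insert K S"] S T1(1) K
      by (meson finite.insertI insert_not_empty insert_subset leD subset_trans)
    then show ?thesis by auto
  qed
  then have "\<Inter>S \<subseteq> N"
    using Inter_T1 by auto
  then obtain K where K: "K \<in> S" "K \<subseteq> N"
    using prime_set_Inter_subset[OF S(1,2) prime_N] ideal S(3) T1(1) by (meson subsetD)
  then have "K = N"
    using S(3) Inter_T1 by auto
  then show False
    using K(1) S(3) by (auto simp: T1_def)
qed

text \<open>Each further functional costs at most one dimension: either it vanishes on the common
  zero set \<open>N\<close> so far, or one \<open>e\<close> in \<open>N\<close> on which it does not
  vanish is enough to correct every representative.\<close>

lemma finite_codim_functionals:
  fixes F :: "('a::cstar_algebra \<Rightarrow> complex) set"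
  assumes "finite F"
    and "\<And>f x y. f \<in> F \<Longrightarrow> f (x + y) = f x + f y"
    and "\<And>f c x. f \<in> F \<Longrightarrow> f (c *\<^sub>C x) = c * f x"
  shows "finite_codim {x. \<forall>f\<in>F. f x = 0}"
  using assms
proof (induction F rule: finite_induct)
  case empty
  then show ?case
    unfolding finite_codim_def by (intro exI[of _ "{}"]) auto
next
  case (insert f F)
  define N where "N = {x. \<forall>g\<in>F. g x = 0}"
  have "finite_codim N"
    unfolding N_def using insert by blast
  then obtain B where B: "finite B" "\<And>a. \<exists>b\<in>cspan B. a - b \<in> N"
    unfolding finite_codim_def by auto
  show ?case
  proof (cases "\<forall>x\<in>N. f x = 0")
    case True
    then have "{x. \<forall>g\<in>insert f F. g x = 0} = N"
      by (auto simp: N_def)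
    then show ?thesis
      using \<open>finite_codim N\<close> by simp
  next
    case False
    then obtain e where e: "e \<in> N" "f e \<noteq> 0"
      by auto
    have diff: "g (x - c *\<^sub>C y) = g x - c * g y" if "g \<in> insert f F" for g x c y
    proof -
      have "g ((x - c *\<^sub>C y) + c *\<^sub>C y) = g (x - c *\<^sub>C y) + c * g y"
        using insert.prems that by metis
      then show ?thesis by simp
    qed
    have "\<exists>b\<in>cspan (insert e B). a - b \<in> {x. \<forall>g\<in>insert f F. g x = 0}" for a
    proof -
      obtain b where b: "b \<in> cspan B" "a - b \<in> N"
        using B(2) by blast
      \<comment> \<open>Chosen so that \<open>f\<close> vanishes at
        \<open>(a - b) - c *\<^sub>C e\<close>; the functionals in \<open>F\<close> vanish there
        anyway, as \<open>e\<close> lies in \<open>N\<close>.\<close>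
      define c where "c = f (a - b) / f e"
      have "b + c *\<^sub>C e \<in> cspan (insert e B)"
        by (meson b(1) complex_vector.span_add complex_vector.span_base complex_vector.span_mono
            complex_vector.span_scale insertI1 subset_insertI subsetD)
      moreover have "g (a - (b + c *\<^sub>C e)) = 0" if "g \<in> insert f F" for g
      proof -
        have "a - (b + c *\<^sub>C e) = (a - b) - c *\<^sub>C e"
          by simp
        then have "g (a - (b + c *\<^sub>C e)) = g (a - b) - c * g e"
          using diff[OF that, of "a - b" c e] by (simp only:)
        then show ?thesis
          using that b(2) e by (auto simp: N_def c_def)
      qed
      ultimately show ?thesis by blast
    qed
    then show ?thesis
      unfolding finite_codim_def by (intro exI[of _ "insert e B"] conjI allI) (simp add: B(1))
  qed
qed

section \<open>Kernels of irreducible representations\<close>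

lemma zero_mat_mult_vec [simp]:
  "v \<in> carrier_vec m \<Longrightarrow> 0\<^sub>m n m *\<^sub>v v = (0\<^sub>v n :: 'a::semiring_0 vec)"
  by (intro eq_vecI) auto

lemma fd_representation_zero:
  assumes "fd_representation k \<pi>"
  shows "\<pi> 0 = 0\<^sub>m k k"
  using fd_representation_diff[OF assms, of 0 0] fd_representationD(1)[OF assms, of 0] by simp

definition rep_kernel :: "nat \<Rightarrow> ('a::cstar_algebra \<Rightarrow> complex mat) \<Rightarrow> 'a set" where
  "rep_kernel k \<pi> = {a. \<pi> a = 0\<^sub>m k k}"

lemma csubspace_rep_kernel:
  assumes "fd_representation k \<pi>"
  shows "csubspace (rep_kernel k \<pi>)"
  by (rule complex_vector.subspaceI)
    (auto simp: rep_kernel_def fd_representationD(2,3)[OF assms] fd_representation_zero[OF assms]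
      intro!: eq_matI)

lemma rep_kernel_ideal:
  assumes "fd_representation k \<pi>" "x \<in> rep_kernel k \<pi>"
  shows "x * a \<in> rep_kernel k \<pi> \<and> a * x \<in> rep_kernel k \<pi>"
  using assms(2) fd_representationD(1)[OF assms(1), of a]
  by (simp add: rep_kernel_def fd_representationD(4)[OF assms(1)])

text \<open>Used in contrapositive form: representations with distinct kernels are
  inequivalent.\<close>

lemma rep_kernel_unitarily_equivalent:
  assumes \<pi>: "fd_representation k \<pi>" and eq: "unitarily_equivalent k \<pi> l \<rho>"
  shows "rep_kernel l \<rho> = rep_kernel k \<pi>"
proof -
  obtain U where U: "U \<in> carrier_mat k k" "mat_adjoint U * U = 1\<^sub>m k" "U * mat_adjoint U = 1\<^sub>m k"
    and \<rho>: "\<And>a. \<rho> a = U * \<pi> a * mat_adjoint U" and kl: "k = l"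
    using eq unfolding unitarily_equivalent_def by auto
  note [simp] = fd_representationD(6,7)[OF \<pi>]
  have [simp]: "dim_row U = k" "dim_col U = k"
    using U(1) by auto
  have \<pi>_\<rho>: "\<pi> a = mat_adjoint U * \<rho> a * U" for a
  proof -
    have "mat_adjoint U * \<rho> a * U = (mat_adjoint U * U) * \<pi> a * (mat_adjoint U * U)"
      by (simp add: \<rho> assoc_mult_mat_dim)
    then show ?thesis
      using fd_representationD(1)[OF \<pi>, of a] by (simp add: U(2))
  qed
  have "\<rho> a = 0\<^sub>m k k" if "\<pi> a = 0\<^sub>m k k" for a
    using U(1) by (simp add: \<rho> that)
  moreover have "\<pi> a = 0\<^sub>m k k" if "\<rho> a = 0\<^sub>m k k" for a
    unfolding \<pi>_\<rho>[of a] that using U(1) by simp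
  ultimately show ?thesis
    by (auto simp: rep_kernel_def kl)
qed

lemma irreducible_invariant_subspace:
  assumes "irreducible_representation k \<pi>" "vec_subspace k W"
    "\<And>a w. w \<in> W \<Longrightarrow> \<pi> a *\<^sub>v w \<in> W"
  shows "W = {0\<^sub>v k} \<or> W = carrier_vec k"
  using assms unfolding irreducible_representation_def subspace_iff_vec_subspace by blast

text \<open>The vectors killed by every \<open>\<pi> a\<close> form an invariant subspace, which is
  proper because an irreducible representation is not zero. This takes the place of unitality, which
  representations are not assumed to have.\<close>

lemma irreducible_nondegenerate:
  assumes irr: "irreducible_representation k \<pi>" and v: "v \<in> carrier_vec k"
    and "\<And>a. \<pi> a *\<^sub>v v = 0\<^sub>v k"
  shows "v = 0\<^sub>v k"
proof -
  have \<pi>: "fd_representation k \<pi>"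
    using irr by (simp add: irreducible_representation_def)
  note D = fd_representationD[OF \<pi>]
  define W where "W = {w \<in> carrier_vec k. \<forall>a. \<pi> a *\<^sub>v w = 0\<^sub>v k}"
  have W: "vec_subspace k W"
  proof -
    have "\<pi> a *\<^sub>v 0\<^sub>v k = 0\<^sub>v k" for a
      using D(1)[of a] by (intro eq_vecI) auto
    moreover have "c \<cdot>\<^sub>v 0\<^sub>v k = 0\<^sub>v k" for c :: complex
      by (intro eq_vecI) auto
    ultimately show ?thesis
      unfolding vec_subspace_def W_def
      by (auto simp: mult_add_distrib_mat_vec[OF D(1)] mult_mat_vec[OF D(1)])
  qed
  have Winv: "\<pi> b *\<^sub>v w \<in> W" if w: "w \<in> W" for b w
  proof -
    have "\<pi> a *\<^sub>v (\<pi> b *\<^sub>v w) = \<pi> (a * b) *\<^sub>v w" for a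
      using w by (simp add: W_def D(4) assoc_mult_mat_vec[OF D(1) D(1)])
    then show ?thesis
      using w D(6) by (simp add: W_def)
  qed
  have "W \<noteq> carrier_vec k"
  proof
    assume "W = carrier_vec k"
    then have "\<pi> a *\<^sub>v w = 0\<^sub>v k" if "w \<in> carrier_vec k" for a w
      using that by (auto simp: W_def)
    then have "\<pi> a = 0\<^sub>m k k" for a
      by (rule zero_matI_mult_vec[OF D(1)])
    then show False
      using irr by (simp add: irreducible_representation_def)
  qed
  then have "W = {0\<^sub>v k}"
    using irreducible_invariant_subspace[OF irr W Winv] by blast
  moreover have "v \<in> W"
    using assms by (simp add: W_def)
  ultimately show ?thesis by simp
qed

text \<open>The orbit of \<open>v\<close> is an invariant subspace, and by
  \<open>irreducible_nondegenerate\<close> it is not zero.\<close>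

lemma irreducible_cyclic:
  assumes irr: "irreducible_representation k \<pi>" and v: "v \<in> carrier_vec k" "v \<noteq> 0\<^sub>v k"
    and w: "w \<in> carrier_vec k"
  obtains a where "\<pi> a *\<^sub>v v = w"
proof -
  have \<pi>: "fd_representation k \<pi>"
    using irr by (simp add: irreducible_representation_def)
  note D = fd_representationD[OF \<pi>]
  define W where "W = range (\<lambda>a. \<pi> a *\<^sub>v v)"
  have W: "vec_subspace k W"
    unfolding vec_subspace_def
  proof (intro conjI ballI allI)
    show "W \<subseteq> carrier_vec k"
      using D(6) by (auto simp: W_def)
    have "\<pi> 0 *\<^sub>v v = 0\<^sub>v k"
      using v(1) by (simp add: fd_representation_zero[OF \<pi>])
    then show "0\<^sub>v k \<in> W"
      unfolding W_def by (metis rangeI)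
    show "x + y \<in> W" if xy: "x \<in> W" "y \<in> W" for x y
    proof -
      obtain a b where "x = \<pi> a *\<^sub>v v" "y = \<pi> b *\<^sub>v v"
        using xy by (auto simp: W_def)
      then have "x + y = \<pi> (a + b) *\<^sub>v v"
        by (simp add: D(2) add_mult_distrib_mat_vec[OF D(1) D(1) v(1)])
      then show ?thesis by (simp add: W_def)
    qed
    show "c \<cdot>\<^sub>v x \<in> W" if x: "x \<in> W" for c x
    proof -
      obtain a where "x = \<pi> a *\<^sub>v v"
        using x by (auto simp: W_def)
      then have "c \<cdot>\<^sub>v x = \<pi> (c *\<^sub>C a) *\<^sub>v v"
        using v(1) D(6,7) by (intro eq_vecI) (auto simp: D(3) smult_scalar_prod_distrib[of _ k])
      then show ?thesis by (simp add: W_def)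
    qed
  qed
  have Winv: "\<pi> b *\<^sub>v x \<in> W" if x: "x \<in> W" for b x
  proof -
    obtain a where "x = \<pi> a *\<^sub>v v"
      using x by (auto simp: W_def)
    then have "\<pi> b *\<^sub>v x = \<pi> (b * a) *\<^sub>v v"
      by (simp add: D(4) assoc_mult_mat_vec[OF D(1) D(1) v(1)])
    then show ?thesis by (simp add: W_def)
  qed
  have "W \<noteq> {0\<^sub>v k}"
  proof
    assume "W = {0\<^sub>v k}"
    then have "\<pi> a *\<^sub>v v = 0\<^sub>v k" for a
      by (metis W_def rangeI singletonD)
    then show False
      using irreducible_nondegenerate[OF irr v(1)] v(2) by blast
  qed
  then have "w \<in> W"
    using irreducible_invariant_subspace[OF irr W Winv] w by blast
  then show ?thesis
    using that by (auto simp: W_def)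
qed

text \<open>Every \<open>\<pi> a\<close> kills the difference of \<open>\<pi> 1 *\<^sub>v v\<close>
  and \<open>v\<close>, so nondegeneracy makes it zero.\<close>

lemma irreducible_one:
  fixes \<pi> :: "'a::unital_cstar_algebra \<Rightarrow> complex mat"
  assumes irr: "irreducible_representation k \<pi>"
  shows "\<pi> 1 = 1\<^sub>m k"
proof (rule mat_eqI_mult_vec[of _ k k])
  have \<pi>: "fd_representation k \<pi>"
    using irr by (simp add: irreducible_representation_def)
  note D = fd_representationD[OF \<pi>]
  show "\<pi> 1 \<in> carrier_mat k k"
    by (rule D(1))
  fix v :: "complex vec" assume v: "v \<in> carrier_vec k"
  have 1: "\<pi> 1 *\<^sub>v v \<in> carrier_vec k"
    by (simp add: D(6))
  define r where "r = \<pi> 1 *\<^sub>v v + (-1) \<cdot>\<^sub>v v"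
  have r: "r \<in> carrier_vec k"
    using v 1 by (simp add: r_def)
  have "\<pi> a *\<^sub>v r = 0\<^sub>v k" for a
  proof -
    have "\<pi> a *\<^sub>v r = \<pi> a *\<^sub>v (\<pi> 1 *\<^sub>v v) + (-1) \<cdot>\<^sub>v (\<pi> a *\<^sub>v v)"
      using v 1 by (simp add: r_def mult_add_distrib_mat_vec[OF D(1)] mult_mat_vec[OF D(1)])
    also have "\<pi> a *\<^sub>v (\<pi> 1 *\<^sub>v v) = \<pi> (a * 1) *\<^sub>v v"
      unfolding D(4) by (rule assoc_mult_mat_vec[OF D(1) D(1) v, symmetric])
    also have "\<pi> (a * 1) *\<^sub>v v + (-1) \<cdot>\<^sub>v (\<pi> a *\<^sub>v v) = 0\<^sub>v k"
      using D(6)[of a] by (intro eq_vecI) auto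
    finally show ?thesis .
  qed
  then have r0: "r = 0\<^sub>v k"
    by (rule irreducible_nondegenerate[OF irr r])
  have "\<pi> 1 *\<^sub>v v = v"
  proof (rule eq_vecI)
    fix i assume i: "i < dim_vec v"
    have "r $ i = 0"
      using r0 i v by simp
    then show "(\<pi> 1 *\<^sub>v v) $ i = v $ i"
      using i v 1 by (simp add: r_def del: index_mult_mat_vec)
  qed (use v 1 in simp)
  then show "\<pi> 1 *\<^sub>v v = 1\<^sub>m k *\<^sub>v v"
    using v by simp
qed simp

text \<open>If \<open>\<pi> y *\<^sub>v v\<close> is non-zero, then it is a cyclic vector; so when
  all \<open>\<pi> (x * a * y)\<close> vanish, \<open>\<pi> x\<close> kills every vector.\<close>

lemma prime_set_rep_kernel:
  assumes irr: "irreducible_representation k \<pi>"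
  shows "prime_set (rep_kernel k \<pi>)"
  unfolding prime_set_def
proof (intro allI impI)
  have \<pi>: "fd_representation k \<pi>"
    using irr by (simp add: irreducible_representation_def)
  note D = fd_representationD[OF \<pi>]
  fix x y assume xy: "\<forall>a. x * a * y \<in> rep_kernel k \<pi>"
  show "x \<in> rep_kernel k \<pi> \<or> y \<in> rep_kernel k \<pi>"
  proof (rule disjCI)
    assume "y \<notin> rep_kernel k \<pi>"
    then obtain v where v: "v \<in> carrier_vec k" "\<pi> y *\<^sub>v v \<noteq> 0\<^sub>v k"
      using zero_matI_mult_vec[OF D(1)[of y]] by (auto simp: rep_kernel_def)
    have "\<pi> x *\<^sub>v w = 0\<^sub>v k" if w: "w \<in> carrier_vec k" for w
    proof -
      have yv: "\<pi> y *\<^sub>v v \<in> carrier_vec k"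
        by (simp add: D(6))
      obtain a where a: "\<pi> a *\<^sub>v (\<pi> y *\<^sub>v v) = w"
        by (rule irreducible_cyclic[OF irr yv v(2) w])
      have "\<pi> x *\<^sub>v w = \<pi> (x * a * y) *\<^sub>v v"
        unfolding a[symmetric] D(4) using v(1) by (simp add: assoc_mult_mat_vec_dim D(6,7))
      then show ?thesis
        using xy v(1) by (simp add: rep_kernel_def)
    qed
    then show "x \<in> rep_kernel k \<pi>"
      using zero_matI_mult_vec[OF D(1)] by (simp add: rep_kernel_def)
  qed
qed

section \<open>Closedness of kernels\<close>

text \<open>The inverse is the Neumann series, and its product with \<open>1 - y\<close>
  telescopes.\<close>

lemma left_inverse_one_minus:
  fixes y :: "'a::{real_normed_algebra_1,banach}"
  assumes "norm y < 1"
  obtains u where "u * (1 - y) = 1"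
proof -
  have sm: "summable (\<lambda>n. y ^ n)"
    by (rule complete_algebra_summable_geometric[OF assms])
  have "(\<lambda>n. y ^ n - y ^ Suc n) sums (y ^ 0 - 0)"
    by (rule telescope_sums') (rule summable_LIMSEQ_zero[OF sm])
  moreover have "(\<lambda>n. y ^ n * (1 - y)) sums (suminf (\<lambda>n. y ^ n) * (1 - y))"
    using sm by (intro sums_mult2 summable_sums)
  moreover have "y ^ n - y ^ Suc n = y ^ n * (1 - y)" for n
    by (simp add: algebra_simps power_commutes)
  ultimately have "suminf (\<lambda>n. y ^ n) * (1 - y) = 1"
    by (simp add: sums_unique2)
  then show ?thesis by (rule that)
qed

text \<open>Replaces contractivity of *-homomorphisms in the proof that kernels are closed.\<close>

lemma irreducible_eigenvalue_bound:
  fixes \<pi> :: "'a::unital_cstar_algebra \<Rightarrow> complex mat"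
  assumes irr: "irreducible_representation k \<pi>" and ev: "eigenvalue (\<pi> c) e"
  shows "cmod e \<le> norm c"
proof (rule ccontr)
  assume "\<not> cmod e \<le> norm c"
  then have lt: "norm c < cmod e" by simp
  then have e: "e \<noteq> 0" "cmod e > 0"
    by (auto intro: le_less_trans[OF norm_ge_zero])
  have \<pi>: "fd_representation k \<pi>"
    using irr by (simp add: irreducible_representation_def)
  note D = fd_representationD[OF \<pi>]
  obtain v where v: "v \<in> carrier_vec k" "v \<noteq> 0\<^sub>v k" "\<pi> c *\<^sub>v v = e \<cdot>\<^sub>v v"
    using ev D(6) by (auto simp: eigenvalue_def eigenvector_def)
  \<comment> \<open>Since \<open>norm y < 1\<close>, the element \<open>1 - y\<close> has a left
    inverse; but \<open>\<pi> (1 - y)\<close> kills the eigenvector \<open>v\<close>, while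
    \<open>\<pi> 1\<close> fixes it.\<close>
  define y where "y = (1 / e) *\<^sub>C c"
  have "norm y < 1"
    using lt e by (simp add: y_def norm_scaleC norm_divide field_simps)
  then obtain u where u: "u * (1 - y) = 1"
    by (rule left_inverse_one_minus)
  have "\<pi> (1 - y) = 1\<^sub>m k - (1 / e) \<cdot>\<^sub>m \<pi> c"
    by (simp add: fd_representation_diff[OF \<pi>] irreducible_one[OF irr] y_def D(3))
  then have "\<pi> (1 - y) *\<^sub>v v = v - ((1 / e) \<cdot>\<^sub>m \<pi> c) *\<^sub>v v"
    using v(1) D(1)[of c] by (simp add: minus_mult_distrib_mat_vec[of _ k k])
  also have "((1 / e) \<cdot>\<^sub>m \<pi> c) *\<^sub>v v = (1 / e) \<cdot>\<^sub>v (\<pi> c *\<^sub>v v)"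
    using v(1) D(6,7)[of c] by (intro eq_vecI) (auto simp: smult_scalar_prod_distrib[of _ k])
  also have "v - (1 / e) \<cdot>\<^sub>v (\<pi> c *\<^sub>v v) = 0\<^sub>v k"
    unfolding v(3) using v(1) e by (intro eq_vecI) auto
  finally have 0: "\<pi> (1 - y) *\<^sub>v v = 0\<^sub>v k" .
  have "v = \<pi> (u * (1 - y)) *\<^sub>v v"
    unfolding u irreducible_one[OF irr] using v(1) by simp
  also have "\<dots> = \<pi> u *\<^sub>v 0\<^sub>v k"
    unfolding D(4) 0[symmetric] by (rule assoc_mult_mat_vec[OF D(1) D(1) v(1)])
  also have "\<dots> = 0\<^sub>v k"
    using D(1)[of u] by (intro eq_vecI) auto
  finally show False
    using v(2) by simp
qed

text \<open>For \<open>z\<close> in the kernel close to \<open>a\<close>, the matrix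
  \<open>mat_adjoint (\<pi> a) * \<pi> a\<close> is the image of \<open>star a * (a - z)\<close>,
  whose norm is as small as desired. So all its eigenvalues are zero, which forces
  \<open>\<pi> a\<close> to vanish.\<close>

lemma closed_rep_kernel:
  fixes \<pi> :: "'a::unital_cstar_algebra \<Rightarrow> complex mat"
  assumes irr: "irreducible_representation k \<pi>"
  shows "closed (rep_kernel k \<pi>)"
proof -
  have \<pi>: "fd_representation k \<pi>"
    using irr by (simp add: irreducible_representation_def)
  note D = fd_representationD[OF \<pi>]
  have "a \<in> rep_kernel k \<pi>" if a: "a \<in> closure (rep_kernel k \<pi>)" for a
  proof -
    have "e = 0" if e: "eigenvalue (mat_adjoint (\<pi> a) * \<pi> a) e" for e
    proof (rule ccontr)
      assume "e \<noteq> 0"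
      \<comment> \<open>This makes \<open>norm (star a) * d\<close> less than \<open>cmod e\<close>;
        the summand 1 yields strictness and a positive denominator.\<close>
      define d where "d = cmod e / (norm (star a) + 1)"
      have pos: "norm (star a) + 1 > 0"
        by (simp add: add_nonneg_pos)
      then have "d > 0"
        using \<open>e \<noteq> 0\<close> by (simp add: d_def)
      then obtain z where z: "z \<in> rep_kernel k \<pi>" "norm (a - z) < d"
        using a by (auto simp: closure_approachable dist_norm norm_minus_commute)
      have "\<pi> a - 0\<^sub>m k k = \<pi> a"
        using D(6,7)[of a] by (intro eq_matI) auto
      then have "\<pi> (star a * (a - z)) = mat_adjoint (\<pi> a) * \<pi> a"
        using z(1) by (simp add: D(4,5) fd_representation_diff[OF \<pi>] rep_kernel_def)
      then have "cmod e \<le> norm (star a * (a - z))"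
        using irreducible_eigenvalue_bound[OF irr, of "star a * (a - z)" e] e by simp
      also have "\<dots> \<le> norm (star a) * norm (a - z)"
        by (rule norm_mult_ineq)
      also have "\<dots> \<le> norm (star a) * d"
        using z(2) by (intro mult_left_mono) auto
      also have "\<dots> < (norm (star a) + 1) * d"
        using \<open>d > 0\<close> by simp
      also have "\<dots> = cmod e"
        using pos by (simp add: d_def)
      finally show False by simp
    qed
    then show ?thesis
      using mat_zero_of_adjoint_mult_eigenvalues_zero[OF D(1)] by (simp add: rep_kernel_def)
  qed
  then show ?thesis
    by (metis closure_subset closure_eq subsetI subset_antisym)
qed

section \<open>From the hypotheses on the algebra to the separating family\<close>

lemma finite_codim_of_finite_dimensional_quotient:
  assumes fd: "finite_dimensional_quotient I" and "csubspace I"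
  shows "finite_codim I"
proof -
  obtain B where B: "finite B" "(\<lambda>b. (+) b ` I) ` cspan B = range (\<lambda>a. (+) a ` I)"
    using fd unfolding finite_dimensional_quotient_def by auto
  have "\<exists>b\<in>cspan B. a - b \<in> I" for a
  proof -
    have "(+) a ` I \<in> (\<lambda>b. (+) b ` I) ` cspan B"
      unfolding B(2) by blast
    then obtain b where b: "b \<in> cspan B" "(+) a ` I = (+) b ` I"
      by auto
    have "a + 0 \<in> (+) a ` I"
      using complex_vector.subspace_0[OF assms(2)] by blast
    then obtain x where "x \<in> I" "a = b + x"
      unfolding b(2) by auto
    then have "a - b \<in> I"
      by simp
    then show ?thesis
      using b(1) by blast
  qed
  then show ?thesis
    unfolding finite_codim_def using B(1) by blast
qed

text \<open>Among the representations that do not vanish at \<open>a\<close>, one of least dimension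
  is irreducible by \<open>irreducible_of_minimal\<close>.\<close>

lemma exists_irreducible_nonzero:
  assumes "residually_finite_dimensional TYPE('a::cstar_algebra)" and "(a :: 'a) \<noteq> 0"
  obtains k \<pi> where "irreducible_representation k \<pi>" "\<pi> a \<noteq> 0\<^sub>m k k"
proof -
  define Q where "Q k \<longleftrightarrow> (\<exists>\<pi>. fd_representation k \<pi> \<and> \<pi> a \<noteq> 0\<^sub>m k k)" for k
  have "\<exists>k. Q k"
    using assms unfolding residually_finite_dimensional_def Q_def by fast
  then have Q: "Q (LEAST k. Q k)" and least: "\<And>m. m < (LEAST k. Q k) \<Longrightarrow> \<not> Q m"
    using not_less_Least by (auto intro: LeastI_ex)
  then obtain \<pi> where \<pi>: "fd_representation (LEAST k. Q k) \<pi>"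
      "\<pi> a \<noteq> 0\<^sub>m (LEAST k. Q k) (LEAST k. Q k)"
    unfolding Q_def by blast
  have "irreducible_representation (LEAST k. Q k) \<pi>"
  proof (rule irreducible_of_minimal[of _ _ a])
    fix m :: nat and \<rho> :: "'a \<Rightarrow> complex mat"
    assume "m < (LEAST k. Q k)" "fd_representation m \<rho>"
    then show "\<rho> a = 0\<^sub>m m m"
      using least[of m] unfolding Q_def by blast
  qed (rule \<pi>)+
  then show ?thesis
    using \<pi>(2) that by blast
qed

text \<open>The intersection is the common zero set of finitely many linear functionals, the matrix
  entries of the \<open>\<pi> i\<close>.\<close>

lemma finite_codim_Inter_rep_kernels:
  fixes \<pi> :: "'i \<Rightarrow> 'a::cstar_algebra \<Rightarrow> complex mat"
  assumes "finite J" and \<pi>: "\<And>i. i \<in> J \<Longrightarrow> fd_representation (k i) (\<pi> i)"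
  shows "finite_codim (\<Inter>i\<in>J. rep_kernel (k i) (\<pi> i))"
proof -
  define F where "F = (\<Union>i\<in>J. (\<lambda>(r, s) a. \<pi> i a $$ (r, s)) ` ({..<k i} \<times> {..<k i}))"
  have "finite_codim {a. \<forall>f\<in>F. f a = 0}"
  proof (rule finite_codim_functionals)
    show "finite F"
      using assms(1) by (simp add: F_def)
    fix f assume "f \<in> F"
    then obtain i r s where f: "f = (\<lambda>a. \<pi> i a $$ (r, s))" and i: "i \<in> J" "r < k i" "s < k i"
      by (auto simp: F_def)
    note D = fd_representationD[OF \<pi>[OF i(1)]]
    show "f (a + b) = f a + f b" "f (c *\<^sub>C a) = c * f a" for a b c
      using i(2,3) by (simp_all add: f D(2,3,6,7))
  qed
  moreover have "{a. \<forall>f\<in>F. f a = 0} = (\<Inter>i\<in>J. rep_kernel (k i) (\<pi> i))"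
  proof (intro equalityI subsetI)
    fix a assume a: "a \<in> {a. \<forall>f\<in>F. f a = 0}"
    show "a \<in> (\<Inter>i\<in>J. rep_kernel (k i) (\<pi> i))"
    proof (intro INT_I)
      fix i assume i: "i \<in> J"
      have "\<pi> i a $$ (r, s) = 0" if rs: "r < k i" "s < k i" for r s
      proof -
        have "(\<lambda>a. \<pi> i a $$ (r, s)) \<in> F"
          unfolding F_def using i rs by (intro UN_I image_eqI[of _ _ "(r, s)"]) auto
        then show ?thesis
          using a bspec[where P = "\<lambda>f. f a = 0"] by blast
      qed
      then have "\<pi> i a = 0\<^sub>m (k i) (k i)"
        using fd_representationD(6,7)[OF \<pi>[OF i]] by (intro eq_matI) auto
      then show "a \<in> rep_kernel (k i) (\<pi> i)"
        by (simp add: rep_kernel_def)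
    qed
  next
    fix a assume "a \<in> (\<Inter>i\<in>J. rep_kernel (k i) (\<pi> i))"
    then show "a \<in> {a. \<forall>f\<in>F. f a = 0}"
      by (auto simp: F_def rep_kernel_def)
  qed
  ultimately show ?thesis by simp
qed

theorem corollary3p11:
  assumes "separable_space (euclidean :: 'a::unital_cstar_algebra topology)"
    and "residually_finite_dimensional TYPE('a)"
    and "just_infinite TYPE('a)"
  shows "strictly_rfd TYPE('a)"
proof -
  \<comment> \<open>Taking the kernels themselves as indices picks one representation for each
    kernel, so distinct indices are inequivalent; \<open>strictly_rfdI\<close> then changes to the
    index type of \<open>strictly_rfd\<close>.\<close>
  define J :: "'a set set"
    where "J = {K. \<exists>k \<pi>. irreducible_representation k \<pi> \<and> K = rep_kernel k \<pi>}"
  have "\<forall>K\<in>J. \<exists>k \<pi>. irreducible_representation k \<pi> \<and> rep_kernel k \<pi> = K"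
    by (auto simp: J_def)
  then obtain k \<pi> where irr: "\<And>K. K \<in> J \<Longrightarrow> irreducible_representation (k K) (\<pi> K)"
    and ker: "\<And>K. K \<in> J \<Longrightarrow> rep_kernel (k K) (\<pi> K) = K"
    by metis
  have rep: "fd_representation (k K) (\<pi> K)" if "K \<in> J" for K
    using irr[OF that] by (simp add: irreducible_representation_def)
  have sub: "csubspace K" and ideal: "\<And>x a. x \<in> K \<Longrightarrow> x * a \<in> K \<and> a * x \<in> K"
    and closed: "closed K" and prime: "prime_set K" if "K \<in> J" for K
    using csubspace_rep_kernel[OF rep[OF that]] rep_kernel_ideal[OF rep[OF that]]
      closed_rep_kernel[OF irr[OF that]] prime_set_rep_kernel[OF irr[OF that]]
    by (simp_all add: ker[OF that])
  have zero: "0 \<in> K" if "K \<in> J" for K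
    using sub[OF that] by (rule complex_vector.subspace_0)
  have Inter_J: "\<Inter>J = {0}"
  proof -
    have "a = 0" if a: "a \<in> \<Inter>J" for a
    proof (rule ccontr)
      assume "a \<noteq> 0"
      then obtain l \<rho> where \<rho>: "irreducible_representation l \<rho>" "\<rho> a \<noteq> 0\<^sub>m l l"
        by (rule exists_irreducible_nonzero[OF assms(2)])
      then have "rep_kernel l \<rho> \<in> J"
        by (auto simp: J_def)
      then show False
        using a \<rho>(2) by (auto simp: rep_kernel_def)
    qed
    then show ?thesis
      using zero by auto
  qed
  have inf_J: "infinite J"
  proof
    assume "finite J"
    then have "finite_codim (\<Inter>K\<in>J. rep_kernel (k K) (\<pi> K))"
      by (rule finite_codim_Inter_rep_kernels) (rule rep)
    also have "(\<Inter>K\<in>J. rep_kernel (k K) (\<pi> K)) = {0}"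
      using ker Inter_J by simp
    finally obtain B :: "'a set" where "finite B" "\<And>a. a \<in> cspan B"
      unfolding finite_codim_def by auto
    then show False
      using assms(3) unfolding just_infinite_def infinite_dimensional_def by blast
  qed
  have Inter_T: "\<Inter>T = {0}" if T: "T \<subseteq> J" "infinite T" for T
  proof (rule ccontr)
    assume "\<Inter>T \<noteq> {0}"
    have subT: "csubspace (\<Inter>T)"
      using T(1) sub by (auto intro!: complex_vector.subspace_Inter)
    moreover have "closed (\<Inter>T)"
      using T(1) closed by (auto intro!: closed_Inter)
    moreover have "a * x \<in> \<Inter>T \<and> x * a \<in> \<Inter>T" if "x \<in> \<Inter>T" for a x
      using ideal T(1) that by blast
    ultimately have "closed_two_sided_ideal (\<Inter>T)"
      unfolding closed_two_sided_ideal_def by blast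
    then have "finite_codim (\<Inter>T)"
      using \<open>\<Inter>T \<noteq> {0}\<close> assms(3) finite_codim_of_finite_dimensional_quotient[OF _ subT]
      unfolding just_infinite_def by blast
    \<comment> \<open>As \<open>T\<close> is a set of kernels, its members are distinct prime ideals
      above \<open>\<Inter>T\<close>, which has finite codimension by just-infiniteness.\<close>
    then have "finite T"
    proof (rule finite_prime_ideals_above)
      fix K assume "K \<in> T"
      then have K: "K \<in> J" using T(1) by auto
      show "csubspace K" "prime_set K" "\<Inter>T \<subseteq> K"
        using sub[OF K] prime[OF K] \<open>K \<in> T\<close> by auto
      show "x * a \<in> K \<and> a * x \<in> K" if "x \<in> K" for x a
        by (rule ideal[OF K that])
    qed
    then show False
      using T(2) by simp
  qed
  have "strictly_rfd_family J k \<pi>"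
    unfolding strictly_rfd_family_def
  proof (intro conjI ballI allI impI)
    show "infinite J" by (rule inf_J)
    show "irreducible_representation (k K) (\<pi> K)" if "K \<in> J" for K
      by (rule irr[OF that])
    show "\<not> unitarily_equivalent (k K) (\<pi> K) (k L) (\<pi> L)" if KL: "K \<in> J" "L \<in> J" "K \<noteq> L" for K L
      using rep_kernel_unitarily_equivalent[OF rep[OF KL(1)], of "k L" "\<pi> L"] ker KL by auto
    show "inj (\<lambda>a. \<lambda>K\<in>T. \<pi> K a)" if T: "T \<subseteq> J \<and> infinite T" for T
    proof (rule injI)
      fix a b assume eq: "(\<lambda>K\<in>T. \<pi> K a) = (\<lambda>K\<in>T. \<pi> K b)"
      have "a - b \<in> K" if K: "K \<in> T" for K
      proof -
        have KJ: "K \<in> J" using T K by auto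
        have "\<pi> K a = \<pi> K b"
          using fun_cong[OF eq, of K] K by simp
        then have "\<pi> K (a - b) = 0\<^sub>m (k K) (k K)"
          using fd_representationD(6,7)[OF rep[OF KJ]]
          by (simp add: fd_representation_diff[OF rep[OF KJ]]) (intro eq_matI; simp)
        then have "a - b \<in> rep_kernel (k K) (\<pi> K)"
          by (simp add: rep_kernel_def)
        then show ?thesis
          by (simp add: ker[OF KJ])
      qed
      then have "a - b \<in> \<Inter>T" by blast
      then show "a = b"
        using Inter_T T by simp
    qed
  qed
  then show ?thesis
    by (rule strictly_rfdI)
qed

end
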